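(* Let $n\ge 1$, let $A,B\in M_n(\mathbb{C})$ and let $1\le p\le\infty$ (with $1/p=0$ if $p=\infty$). Then $$\frac{\max\left(\omega_p(A+B),\,\omega_p(A-B)\right)}{2^{1-\frac1p}}\le \omega_p\left(\begin{bmatrix} 0 & A \\ B & 0 \end{bmatrix}\right)\le\frac{\omega_p(A+B)+\omega_p(A-B)}{2^{1-\frac1p}}.$$
   Context: $M_m(\mathbb{C})$ is the space of $m\times m$ complex matrices, $T^*$ the conjugate transpose, $\operatorname{Re}(T)=\frac12(T+T^* )$. For $1\le p<\infty$, $\|T\|_p=(\operatorname{tr}((T^*T)^{p/2}))^{1/p}$ is the Schatten $p$-norm; $\|T\|_\infty$ is the operator norm. The Schatten $p$-generalized numerical radius of a square complex matrix $T$ is $\omega_p(T)=\sup_{\theta\in\mathbb{R}}\|\operatorname{Re}(e^{i\theta}T)\|_p$. *)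

theory Defs
  imports
    "Jordan_Normal_Form.Schur_Decomposition"
    "HOL-Analysis.L2_Norm"
    "HOL-Library.Extended_Real"
begin

definition mat_trace :: "'a::comm_monoid_add mat \<Rightarrow> 'a" where
  "mat_trace A = (\<Sum>i<dim_row A. A $$ (i, i))"

definition unitary_mat :: "nat \<Rightarrow> complex mat \<Rightarrow> bool" where
  "unitary_mat n U \<longleftrightarrow>
     U \<in> carrier_mat n n \<and> U * mat_adjoint U = 1\<^sub>m n \<and> mat_adjoint U * U = 1\<^sub>m n"

definition re_mat :: "complex mat \<Rightarrow> complex mat" where
  "re_mat T = (1/2) \<cdot>\<^sub>m (T + mat_adjoint T)"

text \<open>
  \<open>psd_powr_rel n A r P\<close>: \<open>P\<close> is obtained from the positive semidefinite \<open>n \<times> n\<close> matrix \<open>A\<close>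
  by applying \<open>\<lambda>x. x powr r\<close> to the eigenvalues in some unitary diagonalization of \<open>A\<close>.
\<close>

definition psd_powr_rel :: "nat \<Rightarrow> complex mat \<Rightarrow> real \<Rightarrow> complex mat \<Rightarrow> bool" where
  "psd_powr_rel n A r P \<longleftrightarrow>
     (\<exists>U d. unitary_mat n U \<and> (\<forall>i<n. 0 \<le> d i) \<and>
        A = U * mat_diag n (\<lambda>i. complex_of_real (d i)) * mat_adjoint U \<and>
        P = U * mat_diag n (\<lambda>i. complex_of_real (d i powr r)) * mat_adjoint U)"

text \<open>
  The power \<open>A\<^sup>r\<close> of a positive semidefinite matrix (functional calculus). The description is
  meaningful because the diagonalization exists by the spectral theorem and the result does not
  depend on it, see \<open>psd_powr_rel_unique\<close> below. By the convention \<open>0 powr r = 0\<close> it is the usual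
  power for \<open>r > 0\<close>, the only case used here.
\<close>

definition psd_powr :: "complex mat \<Rightarrow> real \<Rightarrow> complex mat" where
  "psd_powr A r = (THE P. psd_powr_rel (dim_row A) A r P)"

definition vec_norm2 :: "complex vec \<Rightarrow> real" where
  "vec_norm2 v = L2_set (\<lambda>i. cmod (v $ i)) {..<dim_vec v}"

definition op_norm :: "complex mat \<Rightarrow> real" where
  "op_norm T = (SUP v \<in> {v \<in> carrier_vec (dim_col T). vec_norm2 v \<le> 1}. vec_norm2 (T *\<^sub>v v))"

text \<open>
  \<open>Re\<close> only changes the type: the trace of a positive semidefinite matrix is a nonnegative real.
\<close>

definition schatten_norm :: "ereal \<Rightarrow> complex mat \<Rightarrow> real" where
  "schatten_norm p T =
     (if p = \<infinity> then op_norm T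
      else Re (mat_trace (psd_powr (mat_adjoint T * T) (real_of_ereal p / 2)))
             powr (1 / real_of_ereal p))"

definition schatten_numrad :: "ereal \<Rightarrow> complex mat \<Rightarrow> real" where
  "schatten_numrad p T = (SUP \<theta>::real. schatten_norm p (re_mat (exp (\<i> * complex_of_real \<theta>) \<cdot>\<^sub>m T)))"

lemma mat_adjoint_carrier: "U \<in> carrier_mat m n \<Longrightarrow> mat_adjoint U \<in> carrier_mat n m"
  by (auto simp: mat_adjoint_def)

lemma diag_intertwine:
  fixes d e :: "nat \<Rightarrow> real"
  assumes V: "V \<in> carrier_mat n n"
    and eq: "V * mat_diag n (\<lambda>i. complex_of_real (d i)) = mat_diag n (\<lambda>i. complex_of_real (e i)) * V"
  shows "V * mat_diag n (\<lambda>i. complex_of_real (f (d i))) = mat_diag n (\<lambda>i. complex_of_real (f (e i))) * V"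
proof -
  have "V $$ (i,j) * complex_of_real (f (d j)) = complex_of_real (f (e i)) * V $$ (i,j)"
    if "i < n" "j < n" for i j
  proof -
    have "V $$ (i,j) * complex_of_real (d j) = complex_of_real (e i) * V $$ (i,j)"
      using arg_cong[OF eq, of "\<lambda>M. M $$ (i,j)"] that
      by (simp add: mat_diag_mult_left[OF V] mat_diag_mult_right[OF V])
    then show ?thesis by (cases "V $$ (i,j) = 0") auto
  qed
  then show ?thesis
    by (auto simp: mat_diag_mult_left[OF V] mat_diag_mult_right[OF V] intro!: eq_matI)
qed

lemma psd_powr_rel_unique:
  assumes "psd_powr_rel n A r P" "psd_powr_rel n A r Q"
  shows "P = Q"
proof -
  let ?D = "\<lambda>d. mat_diag n (\<lambda>i. complex_of_real (d i))"
  let ?E = "\<lambda>d. mat_diag n (\<lambda>i. complex_of_real (d i powr r))"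
  obtain U d where U: "unitary_mat n U" and AU: "A = U * ?D d * mat_adjoint U"
    and P: "P = U * ?E d * mat_adjoint U"
    using assms(1) by (auto simp: psd_powr_rel_def)
  obtain W e where W: "unitary_mat n W" and AW: "A = W * ?D e * mat_adjoint W"
    and Q: "Q = W * ?E e * mat_adjoint W"
    using assms(2) by (auto simp: psd_powr_rel_def)
  have c: "U \<in> carrier_mat n n" "W \<in> carrier_mat n n"
      "mat_adjoint U \<in> carrier_mat n n" "mat_adjoint W \<in> carrier_mat n n"
    using U W by (auto simp: unitary_mat_def intro: mat_adjoint_carrier)
  note assoc = assoc_mult_mat[of _ n n _ n _ n] and mc = mult_carrier_mat[of _ n n _ n]
  have u: "U * mat_adjoint U = 1\<^sub>m n" "mat_adjoint U * U = 1\<^sub>m n"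
      "W * mat_adjoint W = 1\<^sub>m n" "mat_adjoint W * W = 1\<^sub>m n"
    using U W by (auto simp: unitary_mat_def)
  define V where "V = mat_adjoint W * U"
  have V: "V \<in> carrier_mat n n" using c by (simp add: V_def)
  have WV: "W * V = U"
    using c u by (simp add: V_def mc flip: assoc)
  have VU: "V * mat_adjoint U = mat_adjoint W"
    using c u by (simp add: V_def assoc mc)
  have "V * ?D d = mat_adjoint W * (U * ?D d * mat_adjoint U) * U"
    using c u by (simp add: V_def assoc mc right_mult_one_mat[of _ n n])
  also have "\<dots> = mat_adjoint W * (W * ?D e * mat_adjoint W) * U"
    using AU AW by simp
  also have "\<dots> = (mat_adjoint W * W) * (?D e * V)"
    using c by (simp add: V_def assoc mc)
  also have "\<dots> = ?D e * V"
    using V u by (simp add: mc left_mult_one_mat[of _ n n])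
  finally have *: "V * ?E d = ?E e * V"
    using diag_intertwine[OF V, of d e "\<lambda>x. x powr r"] by simp
  have "P = W * (V * ?E d) * mat_adjoint U"
    using c V by (simp add: P mc flip: WV assoc)
  also have "\<dots> = W * ?E e * (V * mat_adjoint U)"
    unfolding * using c V by (simp add: assoc mc)
  finally show ?thesis by (simp add: Q VU)
qed

end

theory Submission
  imports Defs "HOL-Analysis.Convex"
begin

text \<open>
  Everything happens on Hermitian matrices, whose Schatten norm is the \<open>\<ell>\<^sup>p\<close> norm of the spectrum.
  The diagonal of a Hermitian matrix in any orthonormal basis is the image of its spectrum under a
  doubly stochastic matrix, so by convexity its \<open>\<ell>\<^sup>p\<close> norm is at most the Schatten norm; reading the
  diagonal of \<open>H + K\<close> in an eigenbasis reduces the triangle inequality to Minkowski's.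

  Write \<open>D(X) = [0, X; X\<^sup>*, 0]\<close>; for Hermitian \<open>H\<close> and \<open>c\<close> of modulus \<open>1\<close>, the norm of
  \<open>D(c H)\<close> is \<open>2\<^bsup>1/p\<^esup>\<close> times that of \<open>H\<close>. For \<open>T = [0, A; B, 0]\<close> and its swap
  \<open>T' = [0, B; A, 0]\<close>, the matrices \<open>R = Re (z T)\<close> and \<open>R' = Re (z T')\<close> with \<open>z = exp (\<i> \<theta>)\<close>
  are unitarily equivalent, while \<open>R + R' = D(Re (z (A + B)))\<close> and
  \<open>R - R' = D(\<i> Re (-\<i> z (A - B)))\<close>. The lower bound is the triangle inequality for
  \<open>R + R'\<close> and \<open>R - R'\<close>, the upper bound the one for \<open>R = (R + R')/2 + (R - R')/2\<close>.
\<close>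

section \<open>\<open>\<ell>\<^sup>p\<close> norms of finite sequences\<close>

text \<open>Sequences are functions of which the first \<open>n\<close> values count, so that the
  entries of a \<open>mat_diag\<close> can be used directly. The maximum ranges over a nonempty set
  only for \<open>1 \<le> n\<close>, whence this hypothesis in what follows.\<close>

definition lp_norm :: "ereal \<Rightarrow> nat \<Rightarrow> (nat \<Rightarrow> real) \<Rightarrow> real" where
  "lp_norm p n f =
     (if p = \<infinity> then Max ((\<lambda>i. \<bar>f i\<bar>) ` {..<n})
      else (\<Sum>i<n. \<bar>f i\<bar> powr real_of_ereal p) powr (1 / real_of_ereal p))"

lemma ereal_ge_1_cases [consumes 1, case_names infinite finite]:
  fixes p :: ereal
  assumes "1 \<le> p"
  obtains "p = \<infinity>" | q where "p = ereal q" "1 \<le> q"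
  using assms by (cases p) auto

text \<open>The absolute value is convex, and the power is increasing and convex on the nonnegative
  reals; the composition is therefore convex on the whole line.\<close>

lemma convex_on_abs_powr:
  assumes "1 \<le> q"
  shows "convex_on UNIV (\<lambda>x::real. \<bar>x\<bar> powr q)"
proof (rule convex_onI)
  fix t x y :: real
  assume t: "0 < t" "t < 1"
  have pos: "((1 - t) * a + t * b) powr q \<le> (1 - t) * a powr q + t * b powr q"
    if ab: "0 \<le> a" "0 \<le> b" for a b
  proof -
    \<comment> \<open>\<open>powr_convex\<close> is applied at positive arguments only. When an
      endpoint is 0, the inequality comes down to \<open>s powr q \<le> s\<close> for
      \<open>s\<close> between 0 and 1.\<close>
    have zero: "(s * c) powr q \<le> s * c powr q" if "0 < s" "s < 1" "0 \<le> c" for s c :: real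
    proof -
      have "s powr q \<le> s powr 1"
        using that assms by (intro powr_mono') auto
      then show ?thesis
        using that by (simp add: powr_mult mult_right_mono)
    qed
    consider "a = 0" | "b = 0" | "0 < a" "0 < b"
      using ab by linarith
    then show ?thesis
    proof cases
      case 3
      then show ?thesis
        using convex_onD[OF powr_convex[OF assms], of t a b] t by simp
    qed (use zero[of "1 - t" a] zero[of t b] t ab assms in auto)
  qed
  have "\<bar>(1 - t) * x + t * y\<bar> powr q \<le> ((1 - t) * \<bar>x\<bar> + t * \<bar>y\<bar>) powr q"
    using t assms
    by (intro powr_mono2) (auto simp: abs_mult intro: order_trans[OF abs_triangle_ineq])
  also have "\<dots> \<le> (1 - t) * \<bar>x\<bar> powr q + t * \<bar>y\<bar> powr q"
    by (rule pos) auto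
  finally show "\<bar>(1 - t) *\<^sub>R x + t *\<^sub>R y\<bar> powr q \<le> (1 - t) * \<bar>x\<bar> powr q + t * \<bar>y\<bar> powr q"
    by simp
qed auto

lemma lp_norm_nonneg:
  assumes "1 \<le> n"
  shows "0 \<le> lp_norm p n f"
proof -
  have "\<bar>f 0\<bar> \<le> Max ((\<lambda>i. \<bar>f i\<bar>) ` {..<n})"
    using assms by (intro Max_ge) auto
  then show ?thesis by (auto simp: lp_norm_def intro: order_trans[OF abs_ge_zero])
qed

lemma lp_norm_cong: "(\<And>i. i < n \<Longrightarrow> f i = g i) \<Longrightarrow> lp_norm p n f = lp_norm p n g"
  by (auto simp: lp_norm_def intro!: arg_cong[of _ _ Max] image_cong)

lemma abs_le_lp_norm_infinity: "i < n \<Longrightarrow> \<bar>f i\<bar> \<le> lp_norm \<infinity> n f"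
  by (simp add: lp_norm_def)

lemma lp_norm_infinity_le:
  assumes "1 \<le> n" "\<And>i. i < n \<Longrightarrow> \<bar>f i\<bar> \<le> c"
  shows "lp_norm \<infinity> n f \<le> c"
  using assms by (auto simp: lp_norm_def lessThan_empty_iff)

lemma lp_norm_powr:
  assumes "1 \<le> q"
  shows "lp_norm (ereal q) n f powr q = (\<Sum>i<n. \<bar>f i\<bar> powr q)"
  using assms by (simp add: lp_norm_def powr_powr sum_nonneg)

lemma lp_norm_le:
  assumes "1 \<le> q" "0 \<le> c" "(\<Sum>i<n. \<bar>f i\<bar> powr q) \<le> c powr q"
  shows "lp_norm (ereal q) n f \<le> c"
proof -
  have "lp_norm (ereal q) n f \<le> (c powr q) powr (1 / q)"
    unfolding lp_norm_def using assms by (auto intro!: powr_mono2 sum_nonneg)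
  then show ?thesis using assms by (simp add: powr_powr)
qed

lemma lp_norm_cmult:
  assumes "1 \<le> n" "1 \<le> p"
  shows "lp_norm p n (\<lambda>i. c * f i) = \<bar>c\<bar> * lp_norm p n f"
  using assms(2)
proof (cases rule: ereal_ge_1_cases)
  case infinite
  have "\<bar>c\<bar> * Max ((\<lambda>i. \<bar>f i\<bar>) ` {..<n}) = Max ((\<lambda>x. \<bar>c\<bar> * x) ` (\<lambda>i. \<bar>f i\<bar>) ` {..<n})"
    using assms by (intro mono_Max_commute) (auto simp: mono_def mult_left_mono lessThan_empty_iff)
  then show ?thesis by (simp add: lp_norm_def infinite image_image abs_mult)
next
  case (finite q)
  then show ?thesis
    by (simp add: lp_norm_def abs_mult powr_mult sum_nonneg powr_powr flip: sum_distrib_left)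
qed

text \<open>Repeating every entry doubles the power sum and leaves the maximum unchanged. For
  infinite \<open>p\<close> the factor is \<open>2 powr 0\<close>. All powers of 2 in the final
  bounds originate here.\<close>

lemma lp_norm_double:
  assumes "1 \<le> n" "1 \<le> p"
  shows "lp_norm p (n + n) (\<lambda>i. f (if i < n then i else i - n))
           = 2 powr real_of_ereal (1 / p) * lp_norm p n f"
  using assms(2)
proof (cases rule: ereal_ge_1_cases)
  case infinite
  have "(\<lambda>i. \<bar>f (if i < n then i else i - n)\<bar>) ` {..<n + n} = (\<lambda>i. \<bar>f i\<bar>) ` {..<n}"
    by (auto intro!: image_eqI)
  then show ?thesis by (simp add: lp_norm_def infinite)
next
  case (finite q)
  have "(\<Sum>i<n + n. \<bar>f (if i < n then i else i - n)\<bar> powr q) = 2 * (\<Sum>i<n. \<bar>f i\<bar> powr q)"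
    using sum.atLeastLessThan_concat[of 0 n "n + n" "\<lambda>i. \<bar>f (if i < n then i else i - n)\<bar> powr q"]
      sum.shift_bounds_nat_ivl[of "\<lambda>i. \<bar>f (if i < n then i else i - n)\<bar> powr q" 0 n n]
    by (simp add: atLeast0LessThan)
  moreover have "real_of_ereal (1 / p) = 1 / q"
    using finite by (simp add: one_ereal_def)
  ultimately show ?thesis
    using finite by (simp add: lp_norm_def powr_mult sum_nonneg)
qed

text \<open>Minkowski's inequality, obtained from convexity of the power function after normalizing
  both sequences.\<close>

lemma lp_norm_triangle:
  assumes "1 \<le> n" "1 \<le> p"
  shows "lp_norm p n (\<lambda>i. f i + g i) \<le> lp_norm p n f + lp_norm p n g"
  using assms(2)
proof (cases rule: ereal_ge_1_cases)
  case infinite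
  have "\<bar>f i + g i\<bar> \<le> lp_norm \<infinity> n f + lp_norm \<infinity> n g" if "i < n" for i
    using abs_le_lp_norm_infinity[OF that, of f] abs_le_lp_norm_infinity[OF that, of g] by linarith
  then show ?thesis
    unfolding infinite by (rule lp_norm_infinity_le[OF assms(1)])
next
  case (finite q)
  define a b where "a = lp_norm p n f" and "b = lp_norm p n g"
  have ab: "0 \<le> a" "0 \<le> b"
    using lp_norm_nonneg[OF assms(1)] by (auto simp: a_def b_def)
  have sums: "(\<Sum>i<n. \<bar>f i\<bar> powr q) = a powr q" "(\<Sum>i<n. \<bar>g i\<bar> powr q) = b powr q"
    using finite lp_norm_powr by (auto simp: a_def b_def)
  \<comment> \<open>A vanishing norm forces every entry to vanish, which settles the cases where
    dividing by the norm is impossible.\<close>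
  have zero: "h i = 0" if "(\<Sum>i<n. \<bar>h i\<bar> powr q) = 0 powr q" "i < n" for h :: "nat \<Rightarrow> real" and i
    using that finite by (simp add: sum_nonneg_eq_0_iff)
  have "(\<Sum>i<n. \<bar>f i + g i\<bar> powr q) \<le> (a + b) powr q"
  proof -
    consider "a = 0" | "b = 0" | "0 < a" "0 < b"
      using ab by linarith
    then show ?thesis
    proof cases
      case 1
      then show ?thesis using zero[of f] sums by simp
    next
      case 2
      then show ?thesis using zero[of g] sums by simp
    next
      case 3
      \<comment> \<open>With this weight, \<open>f + g\<close> is \<open>a + b\<close> times a
        convex combination of \<open>f / a\<close> and \<open>g / b\<close>. Both normalized
        sequences have power sum 1, so summing the convexity estimate leaves exactly
        \<open>(a + b) powr q\<close>.\<close>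
      define t where "t = b / (a + b)"
      have t: "0 \<le> t" "t \<le> 1" "1 - t = a / (a + b)"
        using 3 by (auto simp: t_def field_simps)
      have coeff: "(a + b) * (1 - t) = a" "(a + b) * t = b"
        unfolding t(3) using 3 by (auto simp: t_def)
      have "\<bar>f i + g i\<bar> powr q
              \<le> (a + b) powr q * ((1 - t) * (\<bar>f i\<bar> powr q / a powr q) + t * (\<bar>g i\<bar> powr q / b powr q))" for i
      proof -
        have "f i + g i = (a + b) * ((1 - t) * (f i / a) + t * (g i / b))"
          unfolding distrib_left mult.assoc[symmetric] coeff using 3 by simp
        then have "\<bar>f i + g i\<bar> powr q = (a + b) powr q * \<bar>(1 - t) * (f i / a) + t * (g i / b)\<bar> powr q"
          using 3 by (simp add: abs_mult powr_mult)
        also have "\<dots> \<le> (a + b) powr q * ((1 - t) * \<bar>f i / a\<bar> powr q + t * \<bar>g i / b\<bar> powr q)"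
          using convex_onD[OF convex_on_abs_powr[OF finite(2)], of t "f i / a" "g i / b"] t
          by (intro mult_left_mono) auto
        finally show ?thesis using 3 by (simp add: powr_divide)
      qed
      then have "(\<Sum>i<n. \<bar>f i + g i\<bar> powr q)
          \<le> (\<Sum>i<n. (a + b) powr q * ((1 - t) * (\<bar>f i\<bar> powr q / a powr q) + t * (\<bar>g i\<bar> powr q / b powr q)))"
        by (intro sum_mono)
      also have "\<dots> = (a + b) powr q * ((1 - t) * (a powr q / a powr q) + t * (b powr q / b powr q))"
        by (simp add: sum.distrib flip: sum_distrib_left sum_divide_distrib sums)
      also have "\<dots> = (a + b) powr q" using 3 by simp
      finally show ?thesis .
    qed
  qed
  then show ?thesis
    using lp_norm_le[of q "a + b" "\<lambda>i. f i + g i" n] ab finite by (simp add: a_def b_def)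
qed

text \<open>Each new entry is a weighted average of the old ones. For finite \<open>p\<close>,
  Jensen's inequality in every row bounds the power sum by a double sum, and the column sums
  collapse it; for infinite \<open>p\<close>, an average never exceeds the largest modulus.\<close>

lemma lp_norm_doubly_stochastic_le:
  fixes W :: "nat \<Rightarrow> nat \<Rightarrow> real"
  assumes "1 \<le> n" "1 \<le> p"
    and W: "\<And>i j. 0 \<le> W i j"
    and rows: "\<And>i. i < n \<Longrightarrow> (\<Sum>j<n. W i j) = 1"
    and cols: "\<And>j. j < n \<Longrightarrow> (\<Sum>i<n. W i j) = 1"
  shows "lp_norm p n (\<lambda>i. \<Sum>j<n. W i j * f j) \<le> lp_norm p n f"
  using assms(2)
proof (cases rule: ereal_ge_1_cases)
  case infinite
  have "\<bar>\<Sum>j<n. W i j * f j\<bar> \<le> lp_norm \<infinity> n f" if "i < n" for i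
  proof -
    have "\<bar>\<Sum>j<n. W i j * f j\<bar> \<le> (\<Sum>j<n. W i j * \<bar>f j\<bar>)"
      using W by (intro order_trans[OF sum_abs]) (simp add: abs_mult)
    also have "\<dots> \<le> (\<Sum>j<n. W i j * lp_norm \<infinity> n f)"
      using W by (intro sum_mono mult_left_mono abs_le_lp_norm_infinity) auto
    also have "\<dots> = lp_norm \<infinity> n f"
      by (simp add: rows[OF that] flip: sum_distrib_right)
    finally show ?thesis .
  qed
  then show ?thesis
    unfolding infinite by (rule lp_norm_infinity_le[OF assms(1)])
next
  case (finite q)
  have "(\<Sum>i<n. \<bar>\<Sum>j<n. W i j * f j\<bar> powr q) \<le> (\<Sum>i<n. \<Sum>j<n. W i j * \<bar>f j\<bar> powr q)"
  proof (rule sum_mono)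
    fix i assume "i \<in> {..<n}"
    then show "\<bar>\<Sum>j<n. W i j * f j\<bar> powr q \<le> (\<Sum>j<n. W i j * \<bar>f j\<bar> powr q)"
      using convex_on_sum[OF _ _ convex_on_abs_powr[OF finite(2)], of "{..<n}" "W i" f] W rows[of i] assms(1)
      by auto
  qed
  also have "\<dots> = (\<Sum>j<n. \<bar>f j\<bar> powr q)"
    by (subst sum.swap) (simp add: cols flip: sum_distrib_right)
  also have "\<dots> = lp_norm p n f powr q"
    using finite by (simp add: lp_norm_powr)
  finally show ?thesis
    using finite(2) lp_norm_nonneg[OF assms(1)] unfolding finite(1) by (intro lp_norm_le) auto
qed

section \<open>Spectral theorem\<close>

lemma dim_mat_adjoint [simp]:
  "dim_row (mat_adjoint A) = dim_col A" "dim_col (mat_adjoint A) = dim_row A"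
  by (auto simp: mat_adjoint_def)

lemma index_mat_adjoint [simp]:
  "i < dim_col A \<Longrightarrow> j < dim_row A \<Longrightarrow> mat_adjoint A $$ (i, j) = conjugate (A $$ (j, i))"
  by (simp add: mat_adjoint_def mat_of_rows_index)

lemma index_mult_mat_sum:
  assumes "A \<in> carrier_mat nr n" "B \<in> carrier_mat n nc" "i < nr" "j < nc"
  shows "(A * B) $$ (i, j) = (\<Sum>k<n. A $$ (i, k) * B $$ (k, j))"
  using assms by (simp add: scalar_prod_def atLeast0LessThan)

lemma mat_adjoint_adjoint [simp]: "mat_adjoint (mat_adjoint A) = A"
  by (rule eq_matI) auto

lemma mat_adjoint_mult:
  fixes A B :: "complex mat"
  assumes "A \<in> carrier_mat nr n" "B \<in> carrier_mat n nc"
  shows "mat_adjoint (A * B) = mat_adjoint B * mat_adjoint A"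
  using assms
  by (intro eq_matI)
     (auto simp: index_mult_mat_sum[OF assms] mult.commute
        index_mult_mat_sum[OF mat_adjoint_carrier[OF assms(2)] mat_adjoint_carrier[OF assms(1)]]
      simp del: index_mult_mat(1))

text \<open>Normal form for products of square matrices: adjoints on the factors, brackets to the
  right. The dimension occurs only in the carrier premises, so it has to be instantiated before
  rewriting.\<close>

lemmas square_mat_simps =
  mat_adjoint_mult[of _ n n _ n] assoc_mult_mat[of _ n n _ n _ n]
      mult_carrier_mat[of _ n n _ n] for n

lemma mat_adjoint_add:
  fixes A B :: "complex mat"
  assumes "A \<in> carrier_mat nr nc" "B \<in> carrier_mat nr nc"
  shows "mat_adjoint (A + B) = mat_adjoint A + mat_adjoint B"
  using assms by (intro eq_matI) auto

lemma mat_adjoint_smult: "mat_adjoint (c \<cdot>\<^sub>m A) = cnj c \<cdot>\<^sub>m mat_adjoint (A :: complex mat)"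
  by (intro eq_matI) auto

abbreviation real_diag :: "nat \<Rightarrow> (nat \<Rightarrow> real) \<Rightarrow> complex mat" where
  "real_diag n d \<equiv> mat_diag n (\<lambda>i. complex_of_real (d i))"

lemma mat_adjoint_mat_diag_real [simp]:
  "mat_adjoint (real_diag n d) = real_diag n d"
  by (intro eq_matI) (auto simp: mat_diag_def)

lemma mat_adjoint_zero [simp]: "mat_adjoint (0\<^sub>m m n :: complex mat) = 0\<^sub>m n m"
  by (intro eq_matI) auto

lemma mat_adjoint_one [simp]: "mat_adjoint (1\<^sub>m n :: complex mat) = 1\<^sub>m n"
  by (intro eq_matI) auto

lemma mat_adjoint_four_block:
  fixes A B C D :: "complex mat"
  assumes "A \<in> carrier_mat n n" "B \<in> carrier_mat n m" "C \<in> carrier_mat m n" "D \<in> carrier_mat m m"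
  shows "mat_adjoint (four_block_mat A B C D)
           = four_block_mat (mat_adjoint A) (mat_adjoint C) (mat_adjoint B) (mat_adjoint D)"
  using assms by (intro eq_matI) auto

section \<open>Unitary and block-diagonal matrices\<close>

lemma unitary_matD:
  assumes "unitary_mat n U"
  shows "U \<in> carrier_mat n n" "mat_adjoint U \<in> carrier_mat n n"
    "U * mat_adjoint U = 1\<^sub>m n" "mat_adjoint U * U = 1\<^sub>m n"
  using assms by (auto simp: unitary_mat_def intro: mat_adjoint_carrier)

text \<open>A one-sided inverse of a square matrix is two-sided.\<close>

lemma unitary_matI:
  assumes "U \<in> carrier_mat n n" "mat_adjoint U * U = 1\<^sub>m n"
  shows "unitary_mat n U"
  using assms mat_mult_left_right_inverse[OF mat_adjoint_carrier[OF assms(1)] assms(1)]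
  by (simp add: unitary_mat_def)

lemma unitary_mat_adjoint: "unitary_mat n U \<Longrightarrow> unitary_mat n (mat_adjoint U)"
  by (auto simp: unitary_mat_def intro: mat_adjoint_carrier)

text \<open>Once brackets lean to the right, \<open>U * V\<close> is no longer a subterm; this form
  still cancels the two factors.\<close>

lemma mult_inverse_cancel_left:
  fixes U V X :: "complex mat"
  assumes "U \<in> carrier_mat n n" "V \<in> carrier_mat n n" "X \<in> carrier_mat n m" "U * V = 1\<^sub>m n"
  shows "U * (V * X) = X"
  using assms by (simp flip: assoc_mult_mat[OF assms(1,2,3)])

lemma unitary_mat_mult:
  assumes U: "unitary_mat n U" and V: "unitary_mat n V"
  shows "unitary_mat n (U * V)"
proof (rule unitary_matI)
  note c = unitary_matD[OF U] unitary_matD[OF V]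
  show "U * V \<in> carrier_mat n n" using c by auto
  have "mat_adjoint (U * V) * (U * V) = mat_adjoint V * (mat_adjoint U * (U * V))"
    using c by (simp add: square_mat_simps[where n = n])
  also have "\<dots> = 1\<^sub>m n"
    using c by (simp add: mult_inverse_cancel_left[of _ n])
  finally show "mat_adjoint (U * V) * (U * V) = 1\<^sub>m n" .
qed

lemma four_block_diag_mult:
  fixes A B C D :: "complex mat"
  assumes "A \<in> carrier_mat n n" "B \<in> carrier_mat m m" "C \<in> carrier_mat n n" "D \<in> carrier_mat m m"
  shows "four_block_mat A (0\<^sub>m n m) (0\<^sub>m m n) B * four_block_mat C (0\<^sub>m n m) (0\<^sub>m m n) D
           = four_block_mat (A * C) (0\<^sub>m n m) (0\<^sub>m m n) (B * D)"
  using assms by (subst mult_four_block_mat[of _ n n _ m _ m _ _ n _ m]) auto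

lemma unitary_mat_four_block_diag:
  assumes U: "unitary_mat n U" and V: "unitary_mat m V"
  shows "unitary_mat (n + m) (four_block_mat U (0\<^sub>m n m) (0\<^sub>m m n) V)"
proof (rule unitary_matI)
  note c = unitary_matD[OF U] unitary_matD[OF V]
  show "four_block_mat U (0\<^sub>m n m) (0\<^sub>m m n) V \<in> carrier_mat (n + m) (n + m)"
    using c by auto
  show "mat_adjoint (four_block_mat U (0\<^sub>m n m) (0\<^sub>m m n) V) * four_block_mat U (0\<^sub>m n m) (0\<^sub>m m n) V
          = 1\<^sub>m (n + m)"
    using c by (simp add: mat_adjoint_four_block[of _ n _ m] four_block_diag_mult)
qed

lemma unitary_conj_four_block_diag:
  assumes U: "unitary_mat n U" and V: "unitary_mat m V"
    and C: "C \<in> carrier_mat n n" and D: "D \<in> carrier_mat m m"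
  shows "four_block_mat U (0\<^sub>m n m) (0\<^sub>m m n) V * four_block_mat C (0\<^sub>m n m) (0\<^sub>m m n) D
           * mat_adjoint (four_block_mat U (0\<^sub>m n m) (0\<^sub>m m n) V)
         = four_block_mat (U * C * mat_adjoint U) (0\<^sub>m n m) (0\<^sub>m m n) (V * D * mat_adjoint V)"
proof -
  note c = unitary_matD[OF U] unitary_matD[OF V]
  show ?thesis
    using c C D by (simp add: mat_adjoint_four_block[of _ n _ m] four_block_diag_mult
        mult_carrier_mat[of _ n n _ n] mult_carrier_mat[of _ m m _ m])
qed

lemma four_block_mat_diag:
  "four_block_mat (mat_diag n f) (0\<^sub>m n m) (0\<^sub>m m n) (mat_diag m g)
     = mat_diag (n + m) (\<lambda>i. if i < n then f i else g (i - n))"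
  by (intro eq_matI) (auto simp: mat_diag_def)

section \<open>Diagonalization of Hermitian matrices\<close>

text \<open>Extend \<open>v\<close> to a basis, orthogonalize by Gram-Schmidt, which keeps the first
  vector, and normalize the columns. The scalar \<open>c\<close> stays unspecified because only the
  direction of the first column matters for an eigenvector.\<close>

lemma unitary_completion:
  fixes v :: "complex vec"
  assumes v: "v \<in> carrier_vec n" "v \<noteq> 0\<^sub>v n"
  obtains W c where "unitary_mat n W" "col W 0 = c \<cdot>\<^sub>v v"
proof -
  define b where "b = basis_completion v"
  define ws where "ws = gram_schmidt n b"
  note completion = vec_space.basis_completion[OF v, folded b_def]
  have n: "n \<noteq> 0" using v by (metis carrier_vecD eq_vecI index_zero_vec(2) not_less_zero)
  then obtain vs where bv: "b = v # vs" using completion(6,7) by (cases b) auto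
  have ws: "set ws \<subseteq> carrier_vec n" "corthogonal ws" "length ws = n"
    using cof_vec_space.gram_schmidt_result[OF completion(2,4,5) refl, folded ws_def] completion(6)
    by auto
  have hd: "ws ! 0 = v"
    using cof_vec_space.gram_schmidt_hd[OF v(1), of vs, folded bv ws_def] ws(3) n
    by (metis hd_conv_nth list.size(3))
  have wsi: "ws ! i \<in> carrier_vec n" if "i < n" for i using ws that by auto
  \<comment> \<open>Gram-Schmidt yields orthogonal vectors that are not normalized; these are their
    lengths.\<close>
  define N where "N i = sqrt (Re (ws ! i \<bullet>c ws ! i))" for i
  have sq: "ws ! i \<bullet>c ws ! i = complex_of_real (N i * N i) \<and> N i \<noteq> 0" if "i < n" for i
  proof -
    have "ws ! i \<bullet>c ws ! i \<noteq> 0" using corthogonalD[OF ws(2)] that ws(3) by auto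
    moreover have "0 \<le> ws ! i \<bullet>c ws ! i" by auto
    ultimately show ?thesis by (auto simp: N_def less_eq_complex_def complex_eq_iff)
  qed
  define W where "W = mat n n (\<lambda>(i, j). ws ! j $ i / complex_of_real (N j))"
  have Wc: "W \<in> carrier_mat n n" by (simp add: W_def)
  have "mat_adjoint W * W = 1\<^sub>m n"
  proof (rule eq_matI)
    fix i j assume "i < dim_row (1\<^sub>m n :: complex mat)" "j < dim_col (1\<^sub>m n :: complex mat)"
    then have ij: "i < n" "j < n" by auto
    have "(mat_adjoint W * W) $$ (i, j)
        = (\<Sum>k<n. cnj (ws ! i $ k / complex_of_real (N i)) * (ws ! j $ k / complex_of_real (N j)))"
      using ij by (subst index_mult_mat_sum[OF mat_adjoint_carrier[OF Wc] Wc]) (auto simp: W_def)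
    also have "\<dots> = (ws ! j \<bullet>c ws ! i) / complex_of_real (N i * N j)"
      using wsi[OF ij(1)] wsi[OF ij(2)]
      by (simp add: scalar_prod_def sum_divide_distrib atLeast0LessThan mult.commute)
    also have "\<dots> = 1\<^sub>m n $$ (i, j)"
      using sq[OF ij(1)] corthogonalD[OF ws(2)] ws(3) ij by auto
    finally show "(mat_adjoint W * W) $$ (i, j) = 1\<^sub>m n $$ (i, j)" .
  qed (use Wc in auto)
  then have "unitary_mat n W" by (rule unitary_matI[OF Wc])
  moreover have "col W 0 = (1 / complex_of_real (N 0)) \<cdot>\<^sub>v v"
    using n v(1) hd by (intro eq_vecI) (auto simp: W_def)
  ultimately show thesis by (rule that)
qed

text \<open>Induction by deflation: in an orthonormal basis that starts with an eigenvector, the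
  matrix splits into a 1 by 1 block and a smaller Hermitian block.\<close>

theorem hermitian_diagonalization:
  assumes "A \<in> carrier_mat n n" "mat_adjoint A = (A :: complex mat)"
  obtains U d where "unitary_mat n U"
    "A = U * real_diag n d * mat_adjoint U"
proof -
  have "\<exists>U d. unitary_mat n U \<and> A = U * real_diag n d * mat_adjoint U"
    using assms
  proof (induction n arbitrary: A)
    case 0
    then show ?case
      by (intro exI[of _ "1\<^sub>m 0"]) (auto simp: unitary_mat_def intro!: eq_matI)
  next
    case (Suc n)
    note A = Suc.prems
    let ?D = "\<lambda>n d. real_diag n d"
    \<comment> \<open>The characteristic polynomial splits into \<open>Suc n\<close> linear factors
      over the complex numbers, hence has a root.\<close>
    obtain e where "poly (char_poly A) e = 0"
    proof -
      obtain as where "char_poly A = (\<Prod>a\<leftarrow>as. [:- a, 1:])" "length as = Suc n"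
        using char_poly_factorized[OF A(1)] by blast
      then show thesis using that by (cases as) auto
    qed
    then obtain v where "eigenvector A v e"
      using eigenvalue_root_char_poly[OF A(1)] by (auto simp: eigenvalue_def)
    then have v: "v \<in> carrier_vec (Suc n)" "v \<noteq> 0\<^sub>v (Suc n)" "A *\<^sub>v v = e \<cdot>\<^sub>v v"
      using A by (auto simp: eigenvector_def)
    obtain W c where W: "unitary_mat (Suc n) W" "col W 0 = c \<cdot>\<^sub>v v"
      using unitary_completion[OF v(1,2)] .
    note Wc = unitary_matD[OF W(1)]
    define M where "M = mat_adjoint W * (A * W)"
    have M: "M \<in> carrier_mat (Suc n) (Suc n)" using Wc A by (auto simp: M_def)
    have Mh: "mat_adjoint M = M"
      using Wc A by (simp add: M_def square_mat_simps[where n = "Suc n"])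
    have "col (A * W) 0 = e \<cdot>\<^sub>v col W 0"
    proof -
      have "col (A * W) 0 = A *\<^sub>v col W 0" using A Wc by auto
      then show ?thesis using A v by (simp add: W(2) mult_mat_vec smult_smult_assoc mult.commute)
    qed
    then have "col M 0 = mat_adjoint W *\<^sub>v (e \<cdot>\<^sub>v col W 0)"
      using A Wc
      by (simp add: M_def col_mult2[of _ "Suc n" "Suc n" _ "Suc n"] mult_carrier_mat[of _ "Suc n" "Suc n" _ "Suc n"])
    also have "\<dots> = e \<cdot>\<^sub>v (mat_adjoint W *\<^sub>v col W 0)"
      using Wc by (intro mult_mat_vec) (auto intro!: carrier_vecI)
    also have "mat_adjoint W *\<^sub>v col W 0 = col (mat_adjoint W * W) 0"
      using Wc by (intro col_mult2[symmetric]) auto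
    finally have colM: "col M 0 = e \<cdot>\<^sub>v unit_vec (Suc n) 0"
      using Wc by simp
    \<comment> \<open>The first column of \<open>M\<close> is \<open>e\<close> times a unit vector.
      As \<open>M\<close> is Hermitian, its first row has the same shape with \<open>cnj e\<close>;
      comparing the corner entry shows that \<open>e\<close> is real.\<close>
    have M0: "M $$ (i, 0) = (if i = 0 then e else 0)" if "i < Suc n" for i
      using arg_cong[OF colM, of "\<lambda>v. v $ i"] that M by simp
    have M0': "M $$ (0, i) = (if i = 0 then cnj e else 0)" if "i < Suc n" for i
      using arg_cong[OF Mh, of "\<lambda>v. v $$ (0, i)"] that M M0[OF that] by (auto split: if_splits)
    have e: "e = complex_of_real (Re e)"
      using M0[of 0] M0'[of 0] by (simp add: complex_eq_iff)
    define M' where "M' = mat n n (\<lambda>(i, j). M $$ (Suc i, Suc j))"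
    have M': "M' \<in> carrier_mat n n" "mat_adjoint M' = M'"
    proof -
      show "M' \<in> carrier_mat n n" by (simp add: M'_def)
      show "mat_adjoint M' = M'"
      proof (rule eq_matI)
        fix i j assume "i < dim_row M'" "j < dim_col M'"
        then show "mat_adjoint M' $$ (i, j) = M' $$ (i, j)"
          using arg_cong[OF Mh, of "\<lambda>v. v $$ (Suc i, Suc j)"] M by (simp add: M'_def)
      qed (auto simp: M'_def)
    qed
    obtain U d where U: "unitary_mat n U" and MU: "M' = U * ?D n d * mat_adjoint U"
      using Suc.IH[OF M'] by blast
    define V where "V = four_block_mat (1\<^sub>m 1) (0\<^sub>m 1 n) (0\<^sub>m n 1) U"
    have one: "unitary_mat 1 (1\<^sub>m 1)" by (simp add: unitary_mat_def)
    have V: "unitary_mat (Suc n) V"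
      using unitary_mat_four_block_diag[OF one U] by (simp add: V_def)
    note Vc = unitary_matD[OF V]
    \<comment> \<open>The new eigenvalue comes first and the others move up by one index. The test
      \<open>i < 1\<close> fits the form of \<open>four_block_mat_diag\<close>.\<close>
    define d' where "d' i = (if i < 1 then Re e else d (i - 1))" for i
    have D': "?D (Suc n) d' = four_block_mat (?D 1 (\<lambda>_. Re e)) (0\<^sub>m 1 n) (0\<^sub>m n 1) (?D n d)"
      unfolding four_block_mat_diag by (simp add: d'_def if_distrib cong: if_cong)
    have "M = four_block_mat (?D 1 (\<lambda>_. Re e)) (0\<^sub>m 1 n) (0\<^sub>m n 1) M'"
    proof (rule eq_matI)
      fix i j
      assume "i < dim_row (four_block_mat (?D 1 (\<lambda>_. Re e)) (0\<^sub>m 1 n) (0\<^sub>m n 1) M')"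
        "j < dim_col (four_block_mat (?D 1 (\<lambda>_. Re e)) (0\<^sub>m 1 n) (0\<^sub>m n 1) M')"
      then show "M $$ (i, j) = four_block_mat (?D 1 (\<lambda>_. Re e)) (0\<^sub>m 1 n) (0\<^sub>m n 1) M' $$ (i, j)"
        using M0[of i] M0'[of j] M0[of 0] e by (auto simp: M'_def mat_diag_def)
    qed (use M in \<open>auto simp: M'_def mat_diag_def\<close>)
    also have "\<dots> = V * ?D (Suc n) d' * mat_adjoint V"
      unfolding D' V_def MU
      by (simp only: unitary_conj_four_block_diag[OF one U mat_diag_dim mat_diag_dim] mat_adjoint_one
          left_mult_one_mat[OF mat_diag_dim] right_mult_one_mat[OF mat_diag_dim])
    finally have MV: "M = V * ?D (Suc n) d' * mat_adjoint V" .
    have "A = W * (M * mat_adjoint W)"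
      using Wc A unfolding M_def
      by (simp add: square_mat_simps[where n = "Suc n"]
          mult_inverse_cancel_left[of _ "Suc n"])
    also have "\<dots> = (W * V) * ?D (Suc n) d' * mat_adjoint (W * V)"
      unfolding MV using Wc Vc
      by (simp add: square_mat_simps[where n = "Suc n"])
    finally show ?case using unitary_mat_mult[OF W(1) V] by blast
  qed
  then show thesis using that by blast
qed

section \<open>Schatten norms of Hermitian matrices\<close>

lemma mat_trace_mult_commute:
  fixes A B :: "complex mat"
  assumes "A \<in> carrier_mat n m" "B \<in> carrier_mat m n"
  shows "mat_trace (A * B) = mat_trace (B * A)"
proof -
  have "mat_trace (A * B) = (\<Sum>i<n. \<Sum>k<m. A $$ (i, k) * B $$ (k, i))"
    using assms by (simp add: mat_trace_def index_mult_mat_sum[OF assms] del: index_mult_mat(1))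
  also have "\<dots> = (\<Sum>k<m. \<Sum>i<n. B $$ (k, i) * A $$ (i, k))"
    by (subst sum.swap) (simp add: mult.commute)
  also have "\<dots> = mat_trace (B * A)"
    using assms
    by (simp add: mat_trace_def index_mult_mat_sum[OF assms(2,1)] del: index_mult_mat(1))
  finally show ?thesis .
qed

lemma mat_trace_unitary_conj:
  assumes U: "unitary_mat n U" and D: "D \<in> carrier_mat n n"
  shows "mat_trace (U * D * mat_adjoint U) = mat_trace D"
proof -
  note c = unitary_matD[OF U]
  have "mat_trace (U * (D * mat_adjoint U)) = mat_trace (D * mat_adjoint U * U)"
    using c D by (intro mat_trace_mult_commute[of _ n n]) auto
  then show ?thesis
    using c D by (simp add: assoc_mult_mat[of _ n n _ n _ n])
qed

lemma vec_norm2_nonneg: "0 \<le> vec_norm2 v"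
  by (simp add: vec_norm2_def)

lemma of_real_vec_norm2_square:
  "complex_of_real ((vec_norm2 v)\<^sup>2) = conjugate v \<bullet> v"
  by (simp add: vec_norm2_def L2_set_def sum_nonneg scalar_prod_def atLeast0LessThan
      complex_norm_square mult.commute del: of_real_power)

lemma conjugate_mult_mat_vec_scalar_prod:
  fixes M :: "complex mat"
  assumes "M \<in> carrier_mat m n" "v \<in> carrier_vec n"
  shows "conjugate (M *\<^sub>v v) \<bullet> (M *\<^sub>v v) = conjugate v \<bullet> ((mat_adjoint M * M) *\<^sub>v v)"
proof -
  have c: "mat_adjoint M \<in> carrier_mat n m" using assms(1) by (rule mat_adjoint_carrier)
  have "conjugate (M *\<^sub>v v) \<bullet> (M *\<^sub>v v)
      = (\<Sum>k<m. \<Sum>i<n. cnj (M $$ (k, i)) * cnj (v $ i) * (M *\<^sub>v v) $ k)"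
    using assms by (simp add: scalar_prod_def atLeast0LessThan sum_distrib_right)
  also have "\<dots> = (\<Sum>i<n. cnj (v $ i) * (\<Sum>k<m. mat_adjoint M $$ (i, k) * (M *\<^sub>v v) $ k))"
    using assms by (subst sum.swap) (simp add: sum_distrib_left mult_ac)
  also have "\<dots> = conjugate v \<bullet> (mat_adjoint M *\<^sub>v (M *\<^sub>v v))"
    using assms c by (simp add: scalar_prod_def atLeast0LessThan)
  finally show ?thesis using assms c by simp
qed

text \<open>The squared length of \<open>M v\<close> is the quadratic form of
  \<open>mat_adjoint M * M\<close> at \<open>v\<close>. This allows a matrix to be replaced by any
  other one with the same modulus.\<close>

lemma vec_norm2_mult_mat_vec_cong:
  assumes "M \<in> carrier_mat m n" "N \<in> carrier_mat m' n" "v \<in> carrier_vec n"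
    and "mat_adjoint M * M = mat_adjoint N * N"
  shows "vec_norm2 (M *\<^sub>v v) = vec_norm2 (N *\<^sub>v v)"
proof -
  have "complex_of_real ((vec_norm2 (M *\<^sub>v v))\<^sup>2) = complex_of_real ((vec_norm2 (N *\<^sub>v v))\<^sup>2)"
    unfolding of_real_vec_norm2_square
    using assms by (simp add: conjugate_mult_mat_vec_scalar_prod[of _ m n]
        conjugate_mult_mat_vec_scalar_prod[of _ m' n])
  then show ?thesis
    by (simp only: of_real_eq_iff power2_eq_iff_nonneg vec_norm2_nonneg)
qed

lemma vec_norm2_unitary:
  assumes U: "unitary_mat n U" and v: "v \<in> carrier_vec n"
  shows "vec_norm2 (U *\<^sub>v v) = vec_norm2 v"
proof -
  have "vec_norm2 (U *\<^sub>v v) = vec_norm2 (1\<^sub>m n *\<^sub>v v)"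
    using unitary_matD[OF U] v by (intro vec_norm2_mult_mat_vec_cong[of _ n n _ n]) auto
  then show ?thesis using v by simp
qed

lemma mat_diag_mult_vec:
  assumes "v \<in> carrier_vec n"
  shows "mat_diag n f *\<^sub>v v = vec n (\<lambda>i. f i * v $ i)"
  using assms
  by (intro eq_vecI) (auto
      simp: mat_diag_def scalar_prod_def if_distrib[of "\<lambda>x. x * _"] cong: if_cong)

lemma vec_norm2_mat_diag_le:
  assumes v: "v \<in> carrier_vec n"
  shows "vec_norm2 (real_diag n d *\<^sub>v v) \<le> lp_norm \<infinity> n d * vec_norm2 v"
proof (cases "n = 0")
  case True
  then show ?thesis using v by (simp add: mat_diag_mult_vec vec_norm2_def)
next
  case False
  then have nonneg: "0 \<le> lp_norm \<infinity> n d" using lp_norm_nonneg by simp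
  have "vec_norm2 (real_diag n d *\<^sub>v v)
      \<le> L2_set (\<lambda>i. lp_norm \<infinity> n d * cmod (v $ i)) {..<n}"
    unfolding vec_norm2_def mat_diag_mult_vec[OF v] using abs_le_lp_norm_infinity
    by (auto intro!: L2_set_mono mult_right_mono simp: norm_mult)
  also have "\<dots> = lp_norm \<infinity> n d * vec_norm2 v"
    using v nonneg by (simp add: vec_norm2_def L2_set_right_distrib)
  finally show ?thesis .
qed

section \<open>Schatten norms as norms of spectra\<close>

text \<open>\<open>T\<close> stretches vectors exactly as the diagonal matrix times
  \<open>mat_adjoint U\<close> does, and the latter factor is an isometry, so the supremum is that
  of a diagonal matrix.\<close>

lemma op_norm_eq_lp_norm:
  assumes n: "1 \<le> n" and T: "T \<in> carrier_mat n n" and U: "unitary_mat n U"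
    and TT: "mat_adjoint T * T = U * real_diag n (\<lambda>i. (d i)\<^sup>2) * mat_adjoint U"
  shows "op_norm T = lp_norm \<infinity> n d"
proof -
  let ?D = "real_diag n d"
  note c = unitary_matD[OF U]
  have norm: "vec_norm2 (T *\<^sub>v v) = vec_norm2 (?D *\<^sub>v (mat_adjoint U *\<^sub>v v))" if v: "v \<in> carrier_vec n" for v
  proof -
    have "mat_adjoint (?D * mat_adjoint U) * (?D * mat_adjoint U) = U * (?D * ?D) * mat_adjoint U"
      using c by (simp add: square_mat_simps[where n = n] del: mat_diag_diag)
    also have "\<dots> = mat_adjoint T * T"
      unfolding TT by (simp add: power2_eq_square)
    finally have "vec_norm2 (T *\<^sub>v v) = vec_norm2 ((?D * mat_adjoint U) *\<^sub>v v)"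
      using T c v
      by (intro vec_norm2_mult_mat_vec_cong[of _ n n _ n]) (auto simp: mult_carrier_mat[of _ n n _ n])
    then show ?thesis using c v by (simp add: assoc_mult_mat_vec[of _ n n _ n])
  qed
  let ?S = "{v \<in> carrier_vec n. vec_norm2 v \<le> 1}"
  have upper: "vec_norm2 (T *\<^sub>v v) \<le> lp_norm \<infinity> n d" if v: "v \<in> ?S" for v
  proof -
    have "vec_norm2 (T *\<^sub>v v) \<le> lp_norm \<infinity> n d * vec_norm2 (mat_adjoint U *\<^sub>v v)"
      using v c by (auto simp: norm intro!: vec_norm2_mat_diag_le)
    also have "\<dots> \<le> lp_norm \<infinity> n d * 1"
      using v by (intro mult_left_mono) (auto
          simp: vec_norm2_unitary[OF unitary_mat_adjoint[OF U]] lp_norm_nonneg[OF n])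
    finally show ?thesis by simp
  qed
  have "lp_norm \<infinity> n d \<in> (\<lambda>i. \<bar>d i\<bar>) ` {..<n}"
    unfolding lp_norm_def using n by (auto intro!: Max_in simp: lessThan_empty_iff)
  then obtain k where k: "k < n" "lp_norm \<infinity> n d = \<bar>d k\<bar>" by auto
  have norm_unit: "vec_norm2 (x \<cdot>\<^sub>v unit_vec n k) = cmod x" for x
  proof -
    have "L2_set (\<lambda>i. cmod ((x \<cdot>\<^sub>v unit_vec n k) $ i)) {..<n} = L2_set (\<lambda>i. if i = k then cmod x else 0) {..<n}"
      using k(1) by (intro L2_set_cong) (auto simp: unit_vec_def)
    also have "\<dots> = cmod x"
      using k(1) by (simp add: L2_set_def if_distrib[of "\<lambda>x. x\<^sup>2"] cong: if_cong)
    finally show ?thesis by (simp add: vec_norm2_def)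
  qed
  \<comment> \<open>The supremum is attained at the column of \<open>U\<close> that belongs to an
    entry of largest modulus.\<close>
  define v where "v = U *\<^sub>v unit_vec n k"
  have "v \<in> ?S"
    using c norm_unit[of 1] by (auto simp: v_def vec_norm2_unitary[OF U])
  moreover have "vec_norm2 (T *\<^sub>v v) = lp_norm \<infinity> n d"
  proof -
    have v: "v \<in> carrier_vec n" using c by (simp add: v_def)
    have "mat_adjoint U *\<^sub>v v = unit_vec n k"
      unfolding v_def using c by (simp flip: assoc_mult_mat_vec[of _ n n _ n])
    moreover have "?D *\<^sub>v unit_vec n k = complex_of_real (d k) \<cdot>\<^sub>v unit_vec n k"
      using k(1) by (subst mat_diag_mult_vec) (auto simp: unit_vec_def intro!: eq_vecI)
    ultimately show ?thesis by (simp add: norm[OF v] norm_unit k(2))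
  qed
  ultimately have "lp_norm \<infinity> n d \<in> (\<lambda>v. vec_norm2 (T *\<^sub>v v)) ` ?S"
    by (metis (no_types, lifting) image_eqI)
  then show ?thesis
    unfolding op_norm_def carrier_matD(2)[OF T] using upper
    by (intro cSup_eq_maximum) blast+
qed

text \<open>The hypothesis concerns \<open>mat_adjoint T * T\<close> so that matrices which are not
  Hermitian are covered. The \<open>d i\<close> may carry signs; their moduli are the singular
  values.\<close>

lemma schatten_norm_eq_lp_norm:
  assumes n: "1 \<le> n" and p: "1 \<le> p" and T: "T \<in> carrier_mat n n" and U: "unitary_mat n U"
    and TT: "mat_adjoint T * T = U * real_diag n (\<lambda>i. (d i)\<^sup>2) * mat_adjoint U"
  shows "schatten_norm p T = lp_norm p n d"
  using p
proof (cases rule: ereal_ge_1_cases)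
  case infinite
  then show ?thesis using op_norm_eq_lp_norm[OF n T U TT] by (simp add: schatten_norm_def)
next
  case (finite q)
  let ?E = "mat_diag n (\<lambda>i. complex_of_real ((d i)\<^sup>2 powr (q / 2)))"
  \<comment> \<open>By \<open>psd_powr_rel_unique\<close>, one diagonalization determines the
    definite description in \<open>psd_powr\<close>.\<close>
  have "psd_powr_rel n (mat_adjoint T * T) (q / 2) (U * ?E * mat_adjoint U)"
    unfolding psd_powr_rel_def TT using U by (intro exI[of _ U] exI[of _ "\<lambda>i. (d i)\<^sup>2"]) auto
  moreover have "dim_row (mat_adjoint T * T) = n" using T by simp
  ultimately have "psd_powr (mat_adjoint T * T) (q / 2) = U * ?E * mat_adjoint U"
    unfolding psd_powr_def using psd_powr_rel_unique by (metis (no_types, lifting) the_equality)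
  moreover have "mat_trace ?E = complex_of_real (\<Sum>i<n. \<bar>d i\<bar> powr q)"
  proof -
    have "(d i)\<^sup>2 powr (q / 2) = \<bar>d i\<bar> powr q" for i
    proof -
      have "(d i)\<^sup>2 powr (q / 2) = (\<bar>d i\<bar> powr 2) powr (q / 2)" by simp
      then show ?thesis by (simp only: powr_powr) simp
    qed
    then show ?thesis by (simp add: mat_trace_def mat_diag_def)
  qed
  ultimately show ?thesis
    using finite by (simp add: schatten_norm_def lp_norm_def mat_trace_unitary_conj[OF U])
qed

lemma hermitian_square:
  assumes U: "unitary_mat n U"
    and A: "A = U * real_diag n d * mat_adjoint U"
  shows "A * A = U * real_diag n (\<lambda>i. (d i)\<^sup>2) * mat_adjoint U"
proof -
  let ?D = "real_diag n d"
  note c = unitary_matD[OF U]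
  have "A * A = U * (?D * (mat_adjoint U * (U * (?D * mat_adjoint U))))"
    unfolding A using c by (simp add: square_mat_simps[where n = n])
  also have "\<dots> = U * (?D * ?D) * mat_adjoint U"
    using c by (simp add: mult_inverse_cancel_left[of _ n _ _ n] square_mat_simps[where n = n] del: mat_diag_diag)
  finally show ?thesis by (simp add: power2_eq_square)
qed

lemma schatten_norm_hermitian:
  assumes "1 \<le> n" "1 \<le> p" and U: "unitary_mat n U" and A: "mat_adjoint A = A"
    "A = U * real_diag n d * mat_adjoint U"
  shows "schatten_norm p A = lp_norm p n d"
proof (rule schatten_norm_eq_lp_norm[OF assms(1,2) _ U])
  show "A \<in> carrier_mat n n" using A(2) unitary_matD[OF U] by (metis mat_diag_dim mult_carrier_mat)
qed (use hermitian_square[OF U A(2)] A(1) in simp)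

text \<open>If \<open>U\<close> diagonalizes \<open>A\<close>, then \<open>V * U\<close>
  diagonalizes the conjugate with the same eigenvalues.\<close>

lemma schatten_norm_unitary_conj:
  assumes n: "1 \<le> n" and p: "1 \<le> p" and A: "A \<in> carrier_mat n n" "mat_adjoint A = A"
    and V: "unitary_mat n V"
  shows "schatten_norm p (V * A * mat_adjoint V) = schatten_norm p A"
proof -
  obtain U d where U: "unitary_mat n U" and AU: "A = U * real_diag n d * mat_adjoint U"
    using hermitian_diagonalization[OF A] .
  note c = unitary_matD[OF U] unitary_matD[OF V]
  have "mat_adjoint (V * A * mat_adjoint V) = V * A * mat_adjoint V"
    using c A by (simp add: square_mat_simps[where n = n])
  moreover have "V * A * mat_adjoint V = (V * U) * real_diag n d * mat_adjoint (V * U)"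
    unfolding AU using c
    by (simp add: square_mat_simps[where n = n])
  ultimately show ?thesis
    using schatten_norm_hermitian[OF n p unitary_mat_mult[OF V U]]
        schatten_norm_hermitian[OF n p U A(2) AU] by metis
qed

lemma smult_smult_mat: "a \<cdot>\<^sub>m (b \<cdot>\<^sub>m A) = (a * b :: 'a :: semigroup_mult) \<cdot>\<^sub>m A"
  by (intro eq_matI) (auto simp: mult.assoc)

text \<open>For complex \<open>c\<close> the multiple need not be Hermitian, so the norm is read off
  from its modulus squared, in which only \<open>cmod c\<close> survives.\<close>

lemma schatten_norm_smult:
  assumes n: "1 \<le> n" and p: "1 \<le> p" and A: "A \<in> carrier_mat n n" "mat_adjoint A = A"
  shows "schatten_norm p (c \<cdot>\<^sub>m A) = cmod c * schatten_norm p A"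
proof -
  obtain U d where U: "unitary_mat n U" and AU: "A = U * real_diag n d * mat_adjoint U"
    using hermitian_diagonalization[OF A] .
  note u = unitary_matD[OF U]
  have "mat_adjoint (c \<cdot>\<^sub>m A) * (c \<cdot>\<^sub>m A) = (cnj c * c) \<cdot>\<^sub>m (A * A)"
    using A by (simp add: mat_adjoint_smult mult_smult_assoc_mat[of _ n n]
        mult_smult_distrib[of _ n n] smult_smult_mat mult.commute)
  also have "\<dots> = (cnj c * c) \<cdot>\<^sub>m (U * real_diag n (\<lambda>i. (d i)\<^sup>2) * mat_adjoint U)"
    by (simp only: hermitian_square[OF U AU])
  also have "\<dots> = U * ((cnj c * c) \<cdot>\<^sub>m real_diag n (\<lambda>i. (d i)\<^sup>2)) * mat_adjoint U"
    using u by (simp add: mult_smult_assoc_mat[of _ n n _ n] mult_smult_distrib[of _ n n _ n]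
        mult_carrier_mat[of _ n n _ n])
  also have "(cnj c * c) \<cdot>\<^sub>m real_diag n (\<lambda>i. (d i)\<^sup>2)
      = mat_diag n (\<lambda>i. complex_of_real ((cmod c * d i)\<^sup>2))"
    by (intro eq_matI) (auto
        simp: mat_diag_def power_mult_distrib complex_norm_square mult.commute simp flip: of_real_power)
  finally have "schatten_norm p (c \<cdot>\<^sub>m A) = lp_norm p n (\<lambda>i. cmod c * d i)"
    using A by (intro schatten_norm_eq_lp_norm[OF n p _ U]) auto
  then show ?thesis
    using schatten_norm_hermitian[OF n p U A(2) AU] by (simp add: lp_norm_cmult[OF n p])
qed

section \<open>Diagonals and the triangle inequality\<close>

lemma unitary_rows_norm:
  assumes Q: "unitary_mat n Q" and i: "i < n"
  shows "(\<Sum>j<n. (cmod (Q $$ (i, j)))\<^sup>2) = 1"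
proof -
  note c = unitary_matD[OF Q]
  have "complex_of_real (\<Sum>j<n. (cmod (Q $$ (i, j)))\<^sup>2) = (Q * mat_adjoint Q) $$ (i, i)"
    using c i
    by (subst index_mult_mat_sum[OF c(1,2)]) (auto simp: complex_norm_square simp del: of_real_power)
  also have "\<dots> = complex_of_real 1" using c i by simp
  finally show ?thesis by (simp only: of_real_eq_iff)
qed

text \<open>With \<open>Q\<close> the change of basis between the columns of \<open>V\<close> and an
  eigenbasis, the diagonal averages the eigenvalues with weights
  \<open>(cmod (Q $$ (i, j)))\<^sup>2\<close>.\<close>

lemma lp_norm_diagonal_le_schatten_norm:
  assumes n: "1 \<le> n" and p: "1 \<le> p" and A: "A \<in> carrier_mat n n" "mat_adjoint A = A"
    and V: "unitary_mat n V"
  shows "lp_norm p n (\<lambda>i. Re ((mat_adjoint V * A * V) $$ (i, i))) \<le> schatten_norm p A"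
proof -
  obtain U d where U: "unitary_mat n U" and AU: "A = U * real_diag n d * mat_adjoint U"
    using hermitian_diagonalization[OF A] .
  let ?D = "real_diag n d"
  define Q where "Q = mat_adjoint V * U"
  have Q: "unitary_mat n Q"
    unfolding Q_def by (intro unitary_mat_mult unitary_mat_adjoint U V)
  note c = unitary_matD[OF U] unitary_matD[OF V] unitary_matD[OF Q]
  have "mat_adjoint V * A * V = Q * ?D * mat_adjoint Q"
    unfolding AU Q_def using c
    by (simp add: square_mat_simps[where n = n])
  then have "Re ((mat_adjoint V * A * V) $$ (i, i))
      = (\<Sum>j<n. (cmod (Q $$ (i, j)))\<^sup>2 * d j)" if "i < n" for i
  proof -
    have "(Q * ?D * mat_adjoint Q) $$ (i, i)
        = (\<Sum>j<n. Q $$ (i, j) * complex_of_real (d j) * cnj (Q $$ (i, j)))"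
      using c that
      by (subst index_mult_mat_sum[of _ n n _ n]) (auto simp: mat_diag_mult_right[of _ n n])
    also have "\<dots> = complex_of_real (\<Sum>j<n. (cmod (Q $$ (i, j)))\<^sup>2 * d j)"
      by (simp add: complex_norm_square mult_ac del: of_real_power)
    finally show ?thesis
      using \<open>mat_adjoint V * A * V = Q * ?D * mat_adjoint Q\<close> by simp
  qed
  then have "lp_norm p n (\<lambda>i. Re ((mat_adjoint V * A * V) $$ (i, i)))
      = lp_norm p n (\<lambda>i. \<Sum>j<n. (cmod (Q $$ (i, j)))\<^sup>2 * d j)"
    by (intro lp_norm_cong) auto
  also have "\<dots> \<le> lp_norm p n d"
    \<comment> \<open>Rows of the adjoint are conjugated columns of \<open>Q\<close>, so the weights
      are doubly stochastic.\<close>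
    using unitary_rows_norm[OF Q] unitary_rows_norm[OF unitary_mat_adjoint[OF Q]] c
    by (intro lp_norm_doubly_stochastic_le[OF n p]) auto
  also have "\<dots> = schatten_norm p A"
    using schatten_norm_hermitian[OF n p U A(2) AU] by simp
  finally show ?thesis .
qed

theorem schatten_norm_triangle:
  assumes n: "1 \<le> n" and p: "1 \<le> p"
    and A: "A \<in> carrier_mat n n" "mat_adjoint A = A"
    and B: "B \<in> carrier_mat n n" "mat_adjoint B = B"
  shows "schatten_norm p (A + B) \<le> schatten_norm p A + schatten_norm p B"
proof -
  have AB: "A + B \<in> carrier_mat n n" "mat_adjoint (A + B) = A + B"
    using A B by (auto simp: mat_adjoint_add[of _ n n])
  obtain V d where V: "unitary_mat n V" and ABV: "A + B = V * real_diag n d * mat_adjoint V"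
    using hermitian_diagonalization[OF AB] .
  let ?D = "real_diag n d"
  let ?diag = "\<lambda>A i. Re ((mat_adjoint V * A * V) $$ (i, i))"
  note c = unitary_matD[OF V]
  have "?D = mat_adjoint V * (A + B) * V"
    unfolding ABV using c by (simp add: square_mat_simps[where n = n]
        mult_inverse_cancel_left[of _ n _ _ n] right_mult_one_mat[of _ n n])
  also have "\<dots> = mat_adjoint V * A * V + mat_adjoint V * B * V"
    using c A B
    by (simp add: mult_add_distrib_mat[of _ n n _ n] add_mult_distrib_mat[of _ n n _ _ n] mult_carrier_mat[of _ n n _ n])
  finally have D: "?D = mat_adjoint V * A * V + mat_adjoint V * B * V" .
  \<comment> \<open>In an eigenbasis of \<open>A + B\<close> the diagonal of the sum is its entire
    spectrum, while the diagonals of \<open>A\<close> and \<open>B\<close> are controlled by the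
    preceding lemma.\<close>
  have "d i = ?diag A i + ?diag B i" if "i < n" for i
    using arg_cong[OF D, of "\<lambda>M. Re (M $$ (i, i))"] that c A B
    by (simp add: mat_diag_def del: index_mult_mat(1))
  then have "lp_norm p n d = lp_norm p n (\<lambda>i. ?diag A i + ?diag B i)"
    by (intro lp_norm_cong) auto
  also have "\<dots> \<le> lp_norm p n (?diag A) + lp_norm p n (?diag B)"
    by (rule lp_norm_triangle[OF n p])
  also have "\<dots> \<le> schatten_norm p A + schatten_norm p B"
    by (intro add_mono lp_norm_diagonal_le_schatten_norm n p A B V)
  finally show ?thesis
    using schatten_norm_hermitian[OF n p V AB(2) ABV] by simp
qed

section \<open>Off-diagonal block matrices\<close>

lemma re_mat_carrier [simp]: "T \<in> carrier_mat n n \<Longrightarrow> re_mat T \<in> carrier_mat n n"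
  by (auto simp: re_mat_def intro: mat_adjoint_carrier)

lemma re_mat_hermitian:
  assumes "T \<in> carrier_mat n n"
  shows "mat_adjoint (re_mat T) = re_mat T"
  using assms unfolding re_mat_def by (intro eq_matI) auto

lemma schatten_norm_nonneg:
  assumes n: "1 \<le> n" and p: "1 \<le> p" and A: "A \<in> carrier_mat n n" "mat_adjoint A = A"
  shows "0 \<le> schatten_norm p A"
proof -
  obtain U d where "unitary_mat n U" "A = U * real_diag n d * mat_adjoint U"
    using hermitian_diagonalization[OF A] .
  then show ?thesis using schatten_norm_hermitian[OF n p _ A(2)] lp_norm_nonneg[OF n] by metis
qed

text \<open>A real-valued \<open>SUP\<close> is an upper bound only for a bounded family. Here the
  real part of the rotated matrix is cos \<theta> times that of \<open>T\<close> plus sin \<theta>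
  times that of \<open>\<i>\<close> times \<open>T\<close>, so the triangle inequality gives a bound
  independent of \<theta>.\<close>

lemma bdd_above_schatten_norm_re_mat:
  assumes n: "1 \<le> n" and p: "1 \<le> p" and T: "T \<in> carrier_mat n n"
  shows "bdd_above (range (\<lambda>\<theta>. schatten_norm p (re_mat (exp (\<i> * complex_of_real \<theta>) \<cdot>\<^sub>m T))))"
proof (rule bdd_aboveI2)
  fix \<theta> :: real
  let ?A = "re_mat T" and ?B = "re_mat (\<i> \<cdot>\<^sub>m T)"
  let ?cA = "complex_of_real (cos \<theta>) \<cdot>\<^sub>m ?A" and ?sB = "complex_of_real (sin \<theta>) \<cdot>\<^sub>m ?B"
  have herm: "mat_adjoint ?A = ?A" "mat_adjoint ?B = ?B"
    using T by (auto intro!: re_mat_hermitian[of _ n])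
  have "exp (\<i> * complex_of_real \<theta>) = Complex (cos \<theta>) (sin \<theta>)"
    by (simp add: complex_eq_iff Re_exp Im_exp)
  then have eq: "re_mat (exp (\<i> * complex_of_real \<theta>) \<cdot>\<^sub>m T) = ?cA + ?sB"
    using T unfolding re_mat_def by (intro eq_matI) (auto simp: complex_eq_iff field_simps)
  have "schatten_norm p (?cA + ?sB) \<le> schatten_norm p ?cA + schatten_norm p ?sB"
    using T herm by (intro schatten_norm_triangle[OF n p]) (auto simp: mat_adjoint_smult)
  also have "\<dots> = \<bar>cos \<theta>\<bar> * schatten_norm p ?A + \<bar>sin \<theta>\<bar> * schatten_norm p ?B"
    using T herm by (simp add: schatten_norm_smult[OF n p])
  also have "\<dots> \<le> schatten_norm p ?A + schatten_norm p ?B"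
    using schatten_norm_nonneg[OF n p _ herm(1)] schatten_norm_nonneg[OF n p _ herm(2)] T
    by (intro add_mono mult_left_le_one_le) auto
  finally show "schatten_norm p (re_mat (exp (\<i> * complex_of_real \<theta>) \<cdot>\<^sub>m T))
      \<le> schatten_norm p ?A + schatten_norm p ?B" unfolding eq .
qed

lemma schatten_norm_re_mat_le_numrad:
  assumes "1 \<le> n" "1 \<le> p" "T \<in> carrier_mat n n"
  shows "schatten_norm p (re_mat (exp (\<i> * complex_of_real \<theta>) \<cdot>\<^sub>m T)) \<le> schatten_numrad p T"
  unfolding schatten_numrad_def
  by (rule cSUP_upper[OF UNIV_I bdd_above_schatten_norm_re_mat[OF assms]])

lemma schatten_numrad_le:
  assumes "\<And>\<theta>. schatten_norm p (re_mat (exp (\<i> * complex_of_real \<theta>) \<cdot>\<^sub>m T)) \<le> c"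
  shows "schatten_numrad p T \<le> c"
  unfolding schatten_numrad_def using assms by (intro cSUP_least) auto

section \<open>Norms and swaps of off-diagonal matrices\<close>

lemma off_diagonal_square:
  fixes H :: "complex mat"
  assumes H: "H \<in> carrier_mat n n" and c: "cmod c = 1"
  defines "K \<equiv> four_block_mat (0\<^sub>m n n) (c \<cdot>\<^sub>m H) (cnj c \<cdot>\<^sub>m H) (0\<^sub>m n n)"
  shows "K * K = four_block_mat (H * H) (0\<^sub>m n n) (0\<^sub>m n n) (H * H)"
proof -
  have "c * cnj c = 1" using c complex_norm_square[of c] by simp
  moreover have "H * H \<in> carrier_mat n n" using H by simp
  moreover have "1 \<cdot>\<^sub>m X = X" for X :: "complex mat" by (rule eq_matI) simp_all
  ultimately show ?thesis
    unfolding K_def using H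
    by (simp add: mult_four_block_mat[of _ n n _ n _ n _ _ n _ n] smult_smult_mat mult.commute[of "cnj c"]
        mult_smult_assoc_mat[of _ n n _ n] mult_smult_distrib[of _ n n _ n])
qed

lemma real_diag_double:
  "four_block_mat (real_diag n f) (0\<^sub>m n n) (0\<^sub>m n n) (real_diag n f)
     = real_diag (n + n) (\<lambda>i. f (if i < n then i else i - n))"
  unfolding four_block_mat_diag by (simp only: if_distrib[of "\<lambda>i. complex_of_real (f i)"])

text \<open>The block matrix is Hermitian and the phases cancel in its square, which is block
  diagonal with two copies of \<open>H * H\<close>. Each singular value of \<open>H\<close> thus
  occurs twice, and no eigenbasis of the block matrix itself is called for.\<close>

lemma schatten_norm_off_diagonal:
  assumes n: "1 \<le> n" and p: "1 \<le> p" and H: "H \<in> carrier_mat n n" "mat_adjoint H = H"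
    and c: "cmod c = 1"
  shows "schatten_norm p (four_block_mat (0\<^sub>m n n) (c \<cdot>\<^sub>m H) (cnj c \<cdot>\<^sub>m H) (0\<^sub>m n n))
           = 2 powr real_of_ereal (1 / p) * schatten_norm p H"
proof -
  obtain U d where U: "unitary_mat n U" and HU: "H = U * real_diag n d * mat_adjoint U"
    using hermitian_diagonalization[OF H] .
  let ?K = "four_block_mat (0\<^sub>m n n) (c \<cdot>\<^sub>m H) (cnj c \<cdot>\<^sub>m H) (0\<^sub>m n n)"
  let ?V = "four_block_mat U (0\<^sub>m n n) (0\<^sub>m n n) U"
  let ?d = "\<lambda>i. d (if i < n then i else i - n)"
  have V: "unitary_mat (n + n) ?V" by (rule unitary_mat_four_block_diag[OF U U])
  have K: "?K \<in> carrier_mat (n + n) (n + n)" using H by simp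
  have "mat_adjoint ?K = ?K"
    using H by (simp add: mat_adjoint_four_block[of _ n _ n] mat_adjoint_smult)
  then have "mat_adjoint ?K * ?K = four_block_mat (H * H) (0\<^sub>m n n) (0\<^sub>m n n) (H * H)"
    by (simp only: off_diagonal_square[OF H(1) c])
  also have "\<dots> = ?V * real_diag (n + n) (\<lambda>i. (?d i)\<^sup>2) * mat_adjoint ?V"
    by (simp only: real_diag_double[of n "\<lambda>i. (d i)\<^sup>2", symmetric]
        unitary_conj_four_block_diag[OF U U mat_diag_dim mat_diag_dim] hermitian_square[OF U HU])
  finally have "schatten_norm p ?K = lp_norm p (n + n) ?d"
    using n by (intro schatten_norm_eq_lp_norm[OF _ p K V]) simp_all
  then show ?thesis
    by (simp only: schatten_norm_hermitian[OF n p U H(2) HU] lp_norm_double[OF n p])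
qed

lemma swap_conj_off_diagonal:
  fixes X Y :: "complex mat"
  assumes "X \<in> carrier_mat n n" "Y \<in> carrier_mat n n"
  defines "S \<equiv> four_block_mat (0\<^sub>m n n) (1\<^sub>m n) (1\<^sub>m n) (0\<^sub>m n n)"
  shows "unitary_mat (n + n) S"
    and "S * four_block_mat (0\<^sub>m n n) X Y (0\<^sub>m n n) * mat_adjoint S
           = four_block_mat (0\<^sub>m n n) Y X (0\<^sub>m n n)"
proof -
  have adj: "mat_adjoint S = S"
    by (simp add: S_def mat_adjoint_four_block[of _ n _ n])
  have "S * S = 1\<^sub>m (n + n)"
    by (simp add: S_def mult_four_block_mat[of _ n n _ n _ n _ _ n _ n])
  then show "unitary_mat (n + n) S"
    by (intro unitary_matI) (auto simp: adj, simp add: S_def)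
  show "S * four_block_mat (0\<^sub>m n n) X Y (0\<^sub>m n n) * mat_adjoint S
      = four_block_mat (0\<^sub>m n n) Y X (0\<^sub>m n n)"
    unfolding adj using assms(1,2)
    by (simp add: S_def mult_four_block_mat[of _ n n _ n _ n _ _ n _ n])
qed

lemma re_mat_off_diagonal:
  assumes "A \<in> carrier_mat n n" "B \<in> carrier_mat n n"
  shows "re_mat (c \<cdot>\<^sub>m four_block_mat (0\<^sub>m n n) A B (0\<^sub>m n n))
           = four_block_mat (0\<^sub>m n n) ((1/2) \<cdot>\<^sub>m (c \<cdot>\<^sub>m A + cnj c \<cdot>\<^sub>m mat_adjoint B))
               ((1/2) \<cdot>\<^sub>m (c \<cdot>\<^sub>m B + cnj c \<cdot>\<^sub>m mat_adjoint A)) (0\<^sub>m n n)"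
  using assms unfolding re_mat_def by (intro eq_matI) auto

text \<open>Exchanging \<open>A\<close> and \<open>B\<close> exchanges the two nonzero blocks of the
  real part, and so does conjugation by the unitary matrix that swaps the two halves of the
  coordinates.\<close>

lemma schatten_norm_re_mat_off_diagonal_swap:
  assumes n: "1 \<le> n" and p: "1 \<le> p" and A: "A \<in> carrier_mat n n" and B: "B \<in> carrier_mat n n"
  shows "schatten_norm p (re_mat (c \<cdot>\<^sub>m four_block_mat (0\<^sub>m n n) B A (0\<^sub>m n n)))
           = schatten_norm p (re_mat (c \<cdot>\<^sub>m four_block_mat (0\<^sub>m n n) A B (0\<^sub>m n n)))"
proof -
  let ?X = "(1/2) \<cdot>\<^sub>m (c \<cdot>\<^sub>m A + cnj c \<cdot>\<^sub>m mat_adjoint B)"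
  let ?Y = "(1/2) \<cdot>\<^sub>m (c \<cdot>\<^sub>m B + cnj c \<cdot>\<^sub>m mat_adjoint A)"
  have XY: "?X \<in> carrier_mat n n" "?Y \<in> carrier_mat n n"
    using A B by (auto intro: mat_adjoint_carrier)
  have T: "c \<cdot>\<^sub>m four_block_mat (0\<^sub>m n n) A B (0\<^sub>m n n) \<in> carrier_mat (n + n) (n + n)"
    using A B by simp
  show ?thesis
    using schatten_norm_unitary_conj[OF _ p re_mat_carrier[OF T] re_mat_hermitian[OF T] swap_conj_off_diagonal(1)[OF XY]]
      n swap_conj_off_diagonal(2)[OF XY]
    by (simp only: re_mat_off_diagonal[OF A B] re_mat_off_diagonal[OF B A])
qed

section \<open>Sum and difference of the two real parts\<close>

text \<open>The factors \<open>1\<close> and \<open>cnj 1\<close> keep the shape of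
  \<open>schatten_norm_off_diagonal\<close> with phase 1.\<close>

lemma off_diagonal_re_mat_add:
  assumes A: "A \<in> carrier_mat n n" and B: "B \<in> carrier_mat n n"
  shows "four_block_mat (0\<^sub>m n n) (1 \<cdot>\<^sub>m re_mat (z \<cdot>\<^sub>m (A + B))) (cnj 1 \<cdot>\<^sub>m re_mat (z \<cdot>\<^sub>m (A + B))) (0\<^sub>m n n)
           = re_mat (z \<cdot>\<^sub>m four_block_mat (0\<^sub>m n n) A B (0\<^sub>m n n))
             + re_mat (z \<cdot>\<^sub>m four_block_mat (0\<^sub>m n n) B A (0\<^sub>m n n))"
  unfolding re_mat_off_diagonal[OF A B] re_mat_off_diagonal[OF B A] re_mat_def
  using A B by (intro eq_matI) (auto simp: algebra_simps)

text \<open>Subtraction turns the upper block into a skew-Hermitian matrix. The extra quarter turn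
  in \<open>\<i> * z\<close> makes it \<open>\<i>\<close> times a real part, again of the shape of
  \<open>schatten_norm_off_diagonal\<close>.\<close>

lemma off_diagonal_re_mat_diff:
  assumes A: "A \<in> carrier_mat n n" and B: "B \<in> carrier_mat n n"
  shows "four_block_mat (0\<^sub>m n n) (\<i> \<cdot>\<^sub>m re_mat (z \<cdot>\<^sub>m (A - B))) (cnj \<i> \<cdot>\<^sub>m re_mat (z \<cdot>\<^sub>m (A - B))) (0\<^sub>m n n)
           = re_mat ((\<i> * z) \<cdot>\<^sub>m four_block_mat (0\<^sub>m n n) A B (0\<^sub>m n n))
             + (- 1) \<cdot>\<^sub>m re_mat ((\<i> * z) \<cdot>\<^sub>m four_block_mat (0\<^sub>m n n) B A (0\<^sub>m n n))"
  unfolding re_mat_off_diagonal[OF A B] re_mat_off_diagonal[OF B A] re_mat_def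
  using A B by (intro eq_matI) (auto simp: algebra_simps)

lemma schatten_norm_re_mat_add:
  assumes n: "1 \<le> n" and p: "1 \<le> p" and A: "A \<in> carrier_mat n n" and B: "B \<in> carrier_mat n n"
  shows "2 powr real_of_ereal (1 / p) * schatten_norm p (re_mat (z \<cdot>\<^sub>m (A + B)))
           = schatten_norm p (re_mat (z \<cdot>\<^sub>m four_block_mat (0\<^sub>m n n) A B (0\<^sub>m n n))
                              + re_mat (z \<cdot>\<^sub>m four_block_mat (0\<^sub>m n n) B A (0\<^sub>m n n)))"
proof -
  have H: "z \<cdot>\<^sub>m (A + B) \<in> carrier_mat n n" using A B by simp
  have "cmod 1 = 1" by simp
  from schatten_norm_off_diagonal[OF n p re_mat_carrier[OF H] re_mat_hermitian[OF H] this]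
  show ?thesis by (simp only: off_diagonal_re_mat_add[OF A B])
qed

lemma schatten_norm_re_mat_diff:
  assumes n: "1 \<le> n" and p: "1 \<le> p" and A: "A \<in> carrier_mat n n" and B: "B \<in> carrier_mat n n"
  shows "2 powr real_of_ereal (1 / p) * schatten_norm p (re_mat (z \<cdot>\<^sub>m (A - B)))
           = schatten_norm p (re_mat ((\<i> * z) \<cdot>\<^sub>m four_block_mat (0\<^sub>m n n) A B (0\<^sub>m n n))
                              + (- 1) \<cdot>\<^sub>m re_mat ((\<i> * z) \<cdot>\<^sub>m four_block_mat (0\<^sub>m n n) B A (0\<^sub>m n n)))"
proof -
  have H: "z \<cdot>\<^sub>m (A - B) \<in> carrier_mat n n" using A B by (simp add: minus_carrier_mat)
  have "cmod \<i> = 1" by simp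
  from schatten_norm_off_diagonal[OF n p re_mat_carrier[OF H] re_mat_hermitian[OF H] this]
  show ?thesis by (simp only: off_diagonal_re_mat_diff[OF A B])
qed

text \<open>The quarter turn is absorbed into the angle, over which the supremum runs
  anyway.\<close>

lemma exp_i_plus_half_pi:
  "exp (\<i> * complex_of_real (\<theta> + pi / 2)) = \<i> * exp (\<i> * complex_of_real \<theta>)"
  by (simp add: complex_eq_iff Re_exp Im_exp cos_add sin_add)

section \<open>The lower and upper bounds\<close>

lemma schatten_numrad_add_le:
  assumes n: "1 \<le> n" and p: "1 \<le> p" and A: "A \<in> carrier_mat n n" and B: "B \<in> carrier_mat n n"
  shows "2 powr real_of_ereal (1 / p) * schatten_numrad p (A + B)
           \<le> 2 * schatten_numrad p (four_block_mat (0\<^sub>m n n) A B (0\<^sub>m n n))"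
proof -
  let ?T = "four_block_mat (0\<^sub>m n n) A B (0\<^sub>m n n)" and ?T' = "four_block_mat (0\<^sub>m n n) B A (0\<^sub>m n n)"
  define K where "K = 2 powr real_of_ereal (1 / p)"
  have K: "0 < K" by (simp add: K_def)
  have nn: "1 \<le> n + n" using n by simp
  have T: "?T \<in> carrier_mat (n + n) (n + n)" using A B by simp
  \<comment> \<open>The factor \<open>K\<close> goes to the right before the supremum is taken,
    since \<open>schatten_numrad_le\<close> expects a bare norm on the left.\<close>
  have "schatten_norm p (re_mat (exp (\<i> * complex_of_real \<theta>) \<cdot>\<^sub>m (A + B))) \<le> 2 * schatten_numrad p ?T / K" for \<theta>
  proof -
    let ?z = "exp (\<i> * complex_of_real \<theta>)"
    have zT: "?z \<cdot>\<^sub>m ?T \<in> carrier_mat (n + n) (n + n)" "?z \<cdot>\<^sub>m ?T' \<in> carrier_mat (n + n) (n + n)"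
      using A B by simp_all
    have "K * schatten_norm p (re_mat (?z \<cdot>\<^sub>m (A + B)))
        \<le> schatten_norm p (re_mat (?z \<cdot>\<^sub>m ?T)) + schatten_norm p (re_mat (?z \<cdot>\<^sub>m ?T'))"
      unfolding K_def schatten_norm_re_mat_add[OF n p A B]
      by (rule schatten_norm_triangle[OF nn p re_mat_carrier[OF zT(1)] re_mat_hermitian[OF zT(1)]
            re_mat_carrier[OF zT(2)] re_mat_hermitian[OF zT(2)]])
    also have "\<dots> = 2 * schatten_norm p (re_mat (?z \<cdot>\<^sub>m ?T))"
      by (simp only: schatten_norm_re_mat_off_diagonal_swap[OF n p A B] mult_2)
    also have "\<dots> \<le> 2 * schatten_numrad p ?T"
      using schatten_norm_re_mat_le_numrad[OF nn p T] by simp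
    finally show ?thesis using K by (simp add: field_simps)
  qed
  then have "schatten_numrad p (A + B) \<le> 2 * schatten_numrad p ?T / K" by (rule schatten_numrad_le)
  then show ?thesis unfolding K_def[symmetric] using K by (simp add: field_simps)
qed

text \<open>The argument for the sum, carried out at the angle advanced by a quarter turn; the sign
  of the second summand has modulus 1 and does not change its norm.\<close>

lemma schatten_numrad_diff_le:
  assumes n: "1 \<le> n" and p: "1 \<le> p" and A: "A \<in> carrier_mat n n" and B: "B \<in> carrier_mat n n"
  shows "2 powr real_of_ereal (1 / p) * schatten_numrad p (A - B)
           \<le> 2 * schatten_numrad p (four_block_mat (0\<^sub>m n n) A B (0\<^sub>m n n))"
proof -
  let ?T = "four_block_mat (0\<^sub>m n n) A B (0\<^sub>m n n)" and ?T' = "four_block_mat (0\<^sub>m n n) B A (0\<^sub>m n n)"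
  define K where "K = 2 powr real_of_ereal (1 / p)"
  have K: "0 < K" by (simp add: K_def)
  have nn: "1 \<le> n + n" using n by simp
  have T: "?T \<in> carrier_mat (n + n) (n + n)" using A B by simp
  have "schatten_norm p (re_mat (exp (\<i> * complex_of_real \<theta>) \<cdot>\<^sub>m (A - B))) \<le> 2 * schatten_numrad p ?T / K" for \<theta>
  proof -
    let ?z = "exp (\<i> * complex_of_real \<theta>)"
    have zT: "(\<i> * ?z) \<cdot>\<^sub>m ?T \<in> carrier_mat (n + n) (n + n)" "(\<i> * ?z) \<cdot>\<^sub>m ?T' \<in> carrier_mat (n + n) (n + n)"
      using A B by simp_all
    note R = re_mat_carrier[OF zT(1)] re_mat_hermitian[OF zT(1)]
      and R' = re_mat_carrier[OF zT(2)] re_mat_hermitian[OF zT(2)]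
    have neg: "- 1 \<cdot>\<^sub>m re_mat ((\<i> * ?z) \<cdot>\<^sub>m ?T') \<in> carrier_mat (n + n) (n + n)"
      "mat_adjoint (- 1 \<cdot>\<^sub>m re_mat ((\<i> * ?z) \<cdot>\<^sub>m ?T')) = - 1 \<cdot>\<^sub>m re_mat ((\<i> * ?z) \<cdot>\<^sub>m ?T')"
      using R' by (simp_all add: mat_adjoint_smult)
    have "K * schatten_norm p (re_mat (?z \<cdot>\<^sub>m (A - B)))
        \<le> schatten_norm p (re_mat ((\<i> * ?z) \<cdot>\<^sub>m ?T)) + schatten_norm p (- 1 \<cdot>\<^sub>m re_mat ((\<i> * ?z) \<cdot>\<^sub>m ?T'))"
      unfolding K_def schatten_norm_re_mat_diff[OF n p A B]
      by (rule schatten_norm_triangle[OF nn p R neg])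
    also have "\<dots> = 2 * schatten_norm p (re_mat ((\<i> * ?z) \<cdot>\<^sub>m ?T))"
      by (simp add: schatten_norm_smult[OF nn p R'] schatten_norm_re_mat_off_diagonal_swap[OF n p A B])
    also have "\<dots> \<le> 2 * schatten_numrad p ?T"
      using schatten_norm_re_mat_le_numrad[OF nn p T, of "\<theta> + pi / 2"] unfolding exp_i_plus_half_pi by simp
    finally show ?thesis using K by (simp add: field_simps)
  qed
  then have "schatten_numrad p (A - B) \<le> 2 * schatten_numrad p ?T / K" by (rule schatten_numrad_le)
  then show ?thesis unfolding K_def[symmetric] using K by (simp add: field_simps)
qed

lemma schatten_numrad_off_diagonal_le:
  assumes n: "1 \<le> n" and p: "1 \<le> p" and A: "A \<in> carrier_mat n n" and B: "B \<in> carrier_mat n n"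
  shows "schatten_numrad p (four_block_mat (0\<^sub>m n n) A B (0\<^sub>m n n))
           \<le> 2 powr real_of_ereal (1 / p) / 2 * (schatten_numrad p (A + B) + schatten_numrad p (A - B))"
proof (rule schatten_numrad_le)
  fix \<theta> :: real
  let ?T = "four_block_mat (0\<^sub>m n n) A B (0\<^sub>m n n)" and ?T' = "four_block_mat (0\<^sub>m n n) B A (0\<^sub>m n n)"
  define K where "K = 2 powr real_of_ereal (1 / p)"
  \<comment> \<open>\<open>w\<close> lags a quarter turn behind \<open>z\<close>, so the difference
    identity at \<open>w\<close> involves the same \<open>R\<close> and \<open>R'\<close> as the sum
    identity at \<open>z\<close>. The two angles are separately bounded by the two numerical
    radii.\<close>
  define w where "w = exp (\<i> * complex_of_real (\<theta> - pi / 2))"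
  define z where "z = exp (\<i> * complex_of_real \<theta>)"
  have z: "z = \<i> * w" unfolding w_def z_def using exp_i_plus_half_pi[of "\<theta> - pi / 2"] by simp
  have nn: "1 \<le> n + n" using n by simp
  have carr: "A + B \<in> carrier_mat n n" "A - B \<in> carrier_mat n n"
    using A B by (simp_all add: minus_carrier_mat)
  define R R' where "R = re_mat (z \<cdot>\<^sub>m ?T)" and "R' = re_mat (z \<cdot>\<^sub>m ?T')"
  have zT: "z \<cdot>\<^sub>m ?T \<in> carrier_mat (n + n) (n + n)" "z \<cdot>\<^sub>m ?T' \<in> carrier_mat (n + n) (n + n)"
    using A B by simp_all
  note R = re_mat_carrier[OF zT(1), folded R_def] re_mat_hermitian[OF zT(1), folded R_def]
    and R' = re_mat_carrier[OF zT(2), folded R'_def] re_mat_hermitian[OF zT(2), folded R'_def]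
  have P: "R + R' \<in> carrier_mat (n + n) (n + n)" "mat_adjoint (R + R') = R + R'"
    using R R' by (simp_all add: mat_adjoint_add[of _ "n + n" "n + n"])
  have M: "R + - 1 \<cdot>\<^sub>m R' \<in> carrier_mat (n + n) (n + n)" "mat_adjoint (R + - 1 \<cdot>\<^sub>m R') = R + - 1 \<cdot>\<^sub>m R'"
    using R R' by (simp_all add: mat_adjoint_add[of _ "n + n" "n + n"] mat_adjoint_smult)
  have half: "(1/2) \<cdot>\<^sub>m X \<in> carrier_mat (n + n) (n + n) \<and> mat_adjoint ((1/2) \<cdot>\<^sub>m X) = (1/2) \<cdot>\<^sub>m X"
    if "X \<in> carrier_mat (n + n) (n + n)" "mat_adjoint X = X" for X :: "complex mat"
    using that by (simp add: mat_adjoint_smult)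
  have "R = (1/2) \<cdot>\<^sub>m (R + R') + (1/2) \<cdot>\<^sub>m (R + - 1 \<cdot>\<^sub>m R')"
    using R R' by (intro eq_matI) (auto simp: field_simps)
  then have "schatten_norm p R \<le> schatten_norm p ((1/2) \<cdot>\<^sub>m (R + R')) + schatten_norm p ((1/2) \<cdot>\<^sub>m (R + - 1 \<cdot>\<^sub>m R'))"
    using schatten_norm_triangle[OF nn p] half[OF P] half[OF M] by metis
  also have "\<dots> = K / 2 * (schatten_norm p (re_mat (z \<cdot>\<^sub>m (A + B))) + schatten_norm p (re_mat (w \<cdot>\<^sub>m (A - B))))"
    using schatten_norm_re_mat_add[OF n p A B, of z, folded R_def R'_def K_def]
      schatten_norm_re_mat_diff[OF n p A B, of w, folded z, folded R_def R'_def K_def]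
    by (simp add: schatten_norm_smult[OF nn p P] schatten_norm_smult[OF nn p M] distrib_left)
  also have "\<dots> \<le> K / 2 * (schatten_numrad p (A + B) + schatten_numrad p (A - B))"
    unfolding z_def w_def
    by (intro mult_left_mono add_mono schatten_norm_re_mat_le_numrad[OF n p] carr) (simp add: K_def)
  finally show "schatten_norm p (re_mat (exp (\<i> * complex_of_real \<theta>) \<cdot>\<^sub>m ?T))
      \<le> 2 powr real_of_ereal (1 / p) / 2 * (schatten_numrad p (A + B) + schatten_numrad p (A - B))"
    unfolding R_def z_def K_def .
qed

theorem theorem3p2:
  fixes n :: nat and A B :: "complex mat" and p :: ereal
  assumes "n \<ge> 1"
    and "A \<in> carrier_mat n n"
    and "B \<in> carrier_mat n n"
    and "1 \<le> p"
  shows "max (schatten_numrad p (A + B)) (schatten_numrad p (A - B)) / 2 powr (1 - real_of_ereal (1 / p))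
           \<le> schatten_numrad p (four_block_mat (0\<^sub>m n n) A B (0\<^sub>m n n)) \<and>
         schatten_numrad p (four_block_mat (0\<^sub>m n n) A B (0\<^sub>m n n))
           \<le> (schatten_numrad p (A + B) + schatten_numrad p (A - B)) / 2 powr (1 - real_of_ereal (1 / p))"
proof -
  let ?K = "2 powr real_of_ereal (1 / p)"
  \<comment> \<open>The denominator equals \<open>2 / ?K\<close>, so the statement is a
    rearrangement of the three preceding inequalities.\<close>
  have K: "0 < ?K" "2 powr (1 - real_of_ereal (1 / p)) = 2 / ?K"
    by (simp_all add: powr_diff)
  show ?thesis
    unfolding K(2)
    using schatten_numrad_add_le[OF assms(1,4,2,3)] schatten_numrad_diff_le[OF assms(1,4,2,3)]
      schatten_numrad_off_diagonal_le[OF assms(1,4,2,3)] K(1)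
    by (simp add: max_def field_simps)
qed

end
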